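(* Suppose that $\beta\in\mathbb{N}A\cap\mathrm{int}(\mathbb{R}_{\ge0}A)$. For each $\xi\in\mathbb{R}^n$, $$\lim_{k\to\infty}\frac1k\sum_{u\in S_k}u\,P_k(u,\xi)=m(\lambda),$$ where $\lambda=\bar A\xi$ and $m(\lambda)$ is the unique vector $m\in\mathbb{R}_{>0}^n$ satisfying $\beta=Am$ and $\lambda=\bar A\log m$.
   Context: $\mathbb{N}$ denotes the non-negative integers. $A$ is a $d\times n$ matrix with non-negative integer entries and rank $d$, which is a configuration matrix, i.e. $(1,\ldots,1)^T\in\mathbb{R}^n$ lies in the image of $A^T:\mathbb{R}^d\to\mathbb{R}^n$. With $a_i$ the columns of $A$, $\mathbb{N}A=\sum_i\mathbb{N}a_i$ and $\mathbb{R}_{\ge0}A=\sum_i\mathbb{R}_{\ge0}a_i$. $\bar A$ (the Gale transform of $A$) is an $(n-d)\times n$ integer matrix whose rows form a $\mathbb{Z}$-basis of $\mathrm{Ker}(A:\mathbb{Z}^n\to\mathbb{Z}^d)$. $\log$ acts on vectors componentwise. For $k=1,2,\ldots$, $$S_k=\{u\in\mathbb{N}^n\mid Au=k\beta\},\quad Z_k(\xi)=\sum_{u\in S_k}\frac{\exp(u\cdot\xi)}{u!},\quad P_k(u,\xi)=\frac{\exp(u\cdot\xi)}{u!\,Z_k(\xi)}\ (u\in S_k),$$ where $u!=\prod_i u_i!$. When $\beta\in\mathrm{int}(\mathbb{R}_{\ge0}A)$, the system $\beta=Am$, $\lambda=\bar A\log m$ has a unique solution $m\in\mathbb{R}_{>0}^n$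 for every $\lambda\in\mathbb{R}^{n-d}$. *)

theory Defs
  imports "HOL-Analysis.Analysis"
begin

definition real_vec :: "nat ^ 'n \<Rightarrow> real ^ 'n" where
  "real_vec u = (\<chi> j. real (u $ j))"

abbreviation real_mat :: "nat ^ 'n ^ 'd \<Rightarrow> real ^ 'n ^ 'd" where
  "real_mat \<equiv> map_matrix real"

definition configuration_matrix :: "nat ^ 'n ^ 'd \<Rightarrow> bool" where
  "configuration_matrix A \<longleftrightarrow> (\<chi> j. 1) \<in> range (\<lambda>y. transpose (real_mat A) *v y)"

definition nat_cone :: "nat ^ 'n ^ 'd \<Rightarrow> (real ^ 'd) set" where
  "nat_cone A = {\<Sum>j\<in>UNIV. real (c j) *\<^sub>R column j (real_mat A) |c :: 'n \<Rightarrow> nat. True}"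

definition real_cone :: "nat ^ 'n ^ 'd \<Rightarrow> (real ^ 'd) set" where
  "real_cone A = {\<Sum>j\<in>UNIV. c j *\<^sub>R column j (real_mat A) |c :: 'n \<Rightarrow> real. \<forall>j. 0 \<le> c j}"

text \<open>
  A Gale transform is represented by the list of its rows, and accordingly a vector of
  length \<open>n - d\<close> by a list of reals: unlike an index type, a list may be empty, so that
  the case \<open>n = d\<close> is covered.
\<close>

lemma module_int_vec: "module ((*s) :: int \<Rightarrow> int ^ 'n \<Rightarrow> int ^ 'n)"
  by unfold_locales (simp_all add: vec_eq_iff algebra_simps)

definition gale_transform :: "nat ^ 'n ^ 'd \<Rightarrow> (int ^ 'n) list \<Rightarrow> bool" where
  "gale_transform A B \<longleftrightarrow>
     length B = CARD('n) - CARD('d) \<and>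
     distinct B \<and>
     \<not> module.dependent (*s) (set B) \<and>
     module.span (*s) (set B) = {u. map_matrix int A *v u = 0}"

definition gale_mult :: "(int ^ 'n) list \<Rightarrow> real ^ 'n \<Rightarrow> real list" where
  "gale_mult B x = map (\<lambda>b. \<Sum>j\<in>UNIV. real_of_int (b $ j) * x $ j) B"

definition log_vec :: "real ^ 'n \<Rightarrow> real ^ 'n" where
  "log_vec m = (\<chi> j. ln (m $ j))"

definition is_moment_point ::
    "nat ^ 'n ^ 'd \<Rightarrow> (int ^ 'n) list \<Rightarrow> real ^ 'd \<Rightarrow> real list \<Rightarrow> real ^ 'n \<Rightarrow> bool" where
  "is_moment_point A B \<beta> l m \<longleftrightarrow>
     (\<forall>j. 0 < m $ j) \<and> \<beta> = real_mat A *v m \<and> l = gale_mult B (log_vec m)"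

definition moment_point ::
    "nat ^ 'n ^ 'd \<Rightarrow> (int ^ 'n) list \<Rightarrow> real ^ 'd \<Rightarrow> real list \<Rightarrow> real ^ 'n" where
  "moment_point A B \<beta> l = (THE m. is_moment_point A B \<beta> l m)"

text \<open>
  For a configuration matrix the fibres below are finite: \<open>1 = A\<^sup>T y\<close> forces the coordinate
  sum of every element to be \<open>k (y \<bullet> \<beta>)\<close>. Hence the finite sums over them are the intended ones.
\<close>

definition fibre :: "nat ^ 'n ^ 'd \<Rightarrow> real ^ 'd \<Rightarrow> nat \<Rightarrow> (nat ^ 'n) set" where
  "fibre A \<beta> k = {u. real_mat A *v real_vec u = real k *\<^sub>R \<beta>}"

definition vec_fact :: "nat ^ 'n \<Rightarrow> real" where
  "vec_fact u = (\<Prod>j\<in>UNIV. fact (u $ j))"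

definition partition_fun :: "nat ^ 'n ^ 'd \<Rightarrow> real ^ 'd \<Rightarrow> nat \<Rightarrow> real ^ 'n \<Rightarrow> real" where
  "partition_fun A \<beta> k \<xi> = (\<Sum>u\<in>fibre A \<beta> k. exp (real_vec u \<bullet> \<xi>) / vec_fact u)"

definition fibre_prob ::
    "nat ^ 'n ^ 'd \<Rightarrow> real ^ 'd \<Rightarrow> nat \<Rightarrow> nat ^ 'n \<Rightarrow> real ^ 'n \<Rightarrow> real" where
  "fibre_prob A \<beta> k u \<xi> = exp (real_vec u \<bullet> \<xi>) / (vec_fact u * partition_fun A \<beta> k \<xi>)"

end

theory Submission
  imports Defs
begin

text \<open>
  The moment point. Since the rows of \<open>B\<close> span the integer kernel of \<open>A\<close>, and the integer kernel
  spans the real kernel (\<open>real_kernel_in_span_integer_kernel\<close>), the equation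
  \<open>gale_mult B (log_vec m) = gale_mult B \<xi>\<close> says that \<open>log_vec m - \<xi>\<close> is orthogonal to the kernel
  of \<open>A\<close>, that is, lies in the row space. Two solutions \<open>m\<close> and \<open>m'\<close> then satisfy
  \<open>(log_vec m - log_vec m') \<bullet> (m - m') = 0\<close>, and strict monotonicity of the logarithm gives
  \<open>m = m'\<close>. A solution is found from the convex dual: if \<open>p > 0\<close> and \<open>A p = \<beta>\<close>, then a minimiser \<open>z\<close>
  of \<open>\<Sum>\<^sub>j exp (\<xi>\<^sub>j + z\<^sub>j) - p\<^sub>j z\<^sub>j\<close> over the row space of \<open>A\<close> yields \<open>m\<^sub>j = exp (\<xi>\<^sub>j + z\<^sub>j)\<close>.

  The limit. On a fibre, \<open>fibre_prob\<close> does not change when a vector of the row space is added to \<open>\<xi>\<close>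
  (\<open>fibre_prob_add_row_space\<close>). By the configuration property the all-ones vector lies in the row
  space, so \<open>\<xi>\<close> may be replaced by \<open>log (k m)\<close> on the \<open>k\<close>-th fibre. Hence \<open>u\<close> is distributed
  like independent Poisson variables with means \<open>k m\<^sub>j\<close>, conditioned on \<open>A u = k \<beta> = A (k m)\<close>.
  The unconditioned vector concentrates near \<open>k m\<close> exponentially fast in \<open>k\<close>, and conditioning
  cannot destroy this, because the conditioning event has probability \<open>exp (- o(k))\<close>: it contains a
  single lattice point \<open>U\<^sub>k\<close> with \<open>U\<^sub>k / k \<longlonglongrightarrow> m\<close> (\<open>lattice_points_near_ray\<close>), whose Poisson
  weight is \<open>exp (- o(k))\<close> by Stirling's estimate (\<open>log_weight_defect_tendsto_0\<close>).

  For means there is a short way to use this. By \<open>1 + x \<le> exp x\<close> a mean is bounded by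
  a logarithmic moment generating function, and the sum of exponentially tilted weights over
  the fibre is bounded by the sum over all of \<open>\<nat>\<^sup>n\<close>, which is a product of exponential series
  (\<open>mean_le_log_moment_bound\<close>). Tilting coordinate \<open>i\<close> by \<open>t\<close> gives, for \<open>\<bar>t\<bar> \<le> 1\<close> of either sign,
  \<open>t (E\<^sub>i / k - m\<^sub>i) \<le> m\<^sub>i t\<^sup>2 + o(1)\<close> with \<open>E\<close> the mean over the \<open>k\<close>-th fibre; letting \<open>k\<close> tend to infinity
  and then \<open>t\<close> to \<open>0\<close> from both sides proves the claim.
\<close>

section \<open>The real kernel of an integer matrix\<close>

text \<open>
  The row space is written with \<open>transpose\<close> throughout, as in the definition of
  \<open>configuration_matrix\<close>.
\<close>

declare transpose_matrix_vector [simp del]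

definition of_int_vec :: "int ^ 'n \<Rightarrow> real ^ 'n" where
  "of_int_vec u = (\<chi> j. real_of_int (u $ j))"

lemma of_int_vec_nth [simp]: "of_int_vec u $ j = real_of_int (u $ j)"
  by (simp add: of_int_vec_def)

lemma real_vec_nth [simp]: "real_vec u $ j = real (u $ j)"
  by (simp add: real_vec_def)

lemma real_mat_mult_of_int_vec:
  "real_mat A *v of_int_vec u = of_int_vec (map_matrix int A *v u)"
  by (simp add: vec_eq_iff matrix_vector_mult_def)

abbreviation integer_kernel :: "nat ^ 'n ^ 'd \<Rightarrow> (int ^ 'n) set" where
  "integer_kernel A \<equiv> {u. map_matrix int A *v u = 0}"

text \<open>
  Dirichlet's simultaneous approximation theorem, transported from indices below \<open>n\<close> to a
  finite index type.
\<close>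

lemma simultaneous_integer_approximation:
  fixes x :: "real ^ 'n"
  assumes "\<epsilon> > 0"
  obtains q :: int and u :: "int ^ 'n"
  where "q > 0" and "\<And>j. \<bar>of_int q * x $ j - of_int (u $ j)\<bar> < \<epsilon>"
proof -
  obtain N :: nat where N: "1 / real N < \<epsilon>" "N > 0"
    using assms by (metis gr_zeroI inverse_eq_divide real_arch_inverse)
  obtain f where f: "bij_betw f {0..<CARD('n)} (UNIV :: 'n set)"
    using ex_bij_betw_nat_finite[of "UNIV :: 'n set"] by auto
  obtain q p where q: "0 < q"
    and qp: "\<And>i. i < CARD('n) \<Longrightarrow> \<bar>of_int q * x $ f i - of_int (p i)\<bar> < 1 / N"
    using Dirichlet_approx_simult[OF N(2), of "CARD('n)" "\<lambda>i. x $ f i"] by metis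
  define u :: "int ^ 'n" where "u = (\<chi> j. p (inv_into {0..<CARD('n)} f j))"
  have "\<bar>of_int q * x $ j - of_int (u $ j)\<bar> < \<epsilon>" for j
  proof -
    let ?i = "inv_into {0..<CARD('n)} f j"
    have "?i < CARD('n)" "f ?i = j"
      using f inv_into_into[of j f "{0..<CARD('n)}"] f_inv_into_f[of j f "{0..<CARD('n)}"]
      by (auto simp: bij_betw_def)
    then show ?thesis
      using qp[of ?i] N(1) by (simp add: u_def)
  qed
  with q show thesis by (rule that)
qed

text \<open>
  Subspaces are closed, so it is enough to approximate \<open>x\<close> by multiples of integer kernel
  vectors. If \<open>u\<close> is an integer vector very close to \<open>q x\<close>, then \<open>A u = A (u - q x)\<close> is an integer
  vector with entries smaller than \<open>1\<close>; hence \<open>A u = 0\<close>, and \<open>u / q\<close> approximates \<open>x\<close>.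
\<close>

lemma real_kernel_in_span_integer_kernel:
  fixes A :: "nat ^ 'n ^ 'd" and x :: "real ^ 'n"
  assumes "real_mat A *v x = 0"
  shows "x \<in> span (of_int_vec ` integer_kernel A)"
proof -
  let ?K = "span (of_int_vec ` integer_kernel A)"
  \<comment> \<open>all row sums of \<open>A\<close> are smaller than \<open>C\<close>, also when \<open>A = 0\<close>\<close>
  define C where "C = (\<Sum>i\<in>UNIV. \<Sum>j\<in>UNIV. real (A $ i $ j)) + 1"
  have row_le: "(\<Sum>j\<in>UNIV. real (A $ i $ j)) < C" for i
    unfolding C_def using member_le_sum[of i UNIV "\<lambda>i. \<Sum>j\<in>UNIV. real (A $ i $ j)"]
    by (simp add: sum_nonneg)
  have "C > 0" using row_le[of undefined] sum_nonneg[of UNIV "\<lambda>j. real (A $ undefined $ j)"]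
    by force
  have "\<exists>y\<in>?K. dist y x < e" if "e > 0" for e
  proof -
    define \<epsilon> where "\<epsilon> = min (1 / C) (e / CARD('n))"
    have "\<epsilon> > 0" using \<open>C > 0\<close> \<open>e > 0\<close> by (simp add: \<epsilon>_def)
    then obtain q u where q: "q > 0"
      and qu: "\<And>j. \<bar>of_int q * x $ j - of_int (u $ j)\<bar> < \<epsilon>"
      using simultaneous_integer_approximation[of \<epsilon> x] by metis
    have "map_matrix int A *v u = 0"
    proof -
      have "(map_matrix int A *v u) $ i = 0" for i
      proof -
        have "(real_mat A *v x) $ i = 0" by (simp add: assms)
        then have "(\<Sum>j\<in>UNIV. real (A $ i $ j) * x $ j) = 0"
          by (simp add: matrix_vector_mult_def)
        then have "real_of_int ((map_matrix int A *v u) $ i)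
          = (\<Sum>j\<in>UNIV. real (A $ i $ j) * of_int (u $ j))
            - of_int q * (\<Sum>j\<in>UNIV. real (A $ i $ j) * x $ j)"
          by (simp add: matrix_vector_mult_def)
        also have "\<dots> = (\<Sum>j\<in>UNIV. real (A $ i $ j) * (of_int (u $ j) - of_int q * x $ j))"
          by (simp add: sum_distrib_left sum_subtractf algebra_simps)
        finally have "\<bar>real_of_int ((map_matrix int A *v u) $ i)\<bar>
          \<le> (\<Sum>j\<in>UNIV. \<bar>real (A $ i $ j) * (of_int (u $ j) - of_int q * x $ j)\<bar>)"
          by (metis sum_abs)
        also have "\<dots> \<le> (\<Sum>j\<in>UNIV. real (A $ i $ j) * \<epsilon>)"
          using qu by (intro sum_mono) (auto simp: abs_mult abs_minus_commute less_imp_le intro!: mult_left_mono)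
        also have "\<dots> = (\<Sum>j\<in>UNIV. real (A $ i $ j)) * \<epsilon>"
          by (simp add: sum_distrib_right)
        also have "\<dots> < C * \<epsilon>"
          using row_le \<open>\<epsilon> > 0\<close> by simp
        also have "\<dots> \<le> 1"
          using \<open>C > 0\<close> mult_left_mono[of \<epsilon> "1 / C" C] by (simp add: \<epsilon>_def)
        finally show ?thesis by linarith
      qed
      then show ?thesis by (simp add: vec_eq_iff)
    qed
    then have "(1 / of_int q) *\<^sub>R of_int_vec u \<in> ?K"
      by (intro span_scale span_base) auto
    moreover have "dist ((1 / of_int q) *\<^sub>R of_int_vec u) x < e"
    proof -
      have comp: "\<bar>((1 / of_int q) *\<^sub>R of_int_vec u - x) $ j\<bar> < e / CARD('n)" for j
      proof -
        have "((1 / of_int q) *\<^sub>R of_int_vec u - x) $ j = (of_int (u $ j) - of_int q * x $ j) / of_int q"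
          using q by (simp add: field_simps)
        then have "\<bar>((1 / of_int q) *\<^sub>R of_int_vec u - x) $ j\<bar> = \<bar>of_int q * x $ j - of_int (u $ j)\<bar> / of_int q"
          using q by (simp add: abs_minus_commute)
        also have "\<dots> \<le> \<bar>of_int q * x $ j - of_int (u $ j)\<bar>"
          using q by (simp add: divide_le_eq mult_left_le mult_le_cancel_left1)
        also have "\<dots> < e / CARD('n)"
          using qu[of j] by (simp add: \<epsilon>_def)
        finally show ?thesis .
      qed
      have "dist ((1 / of_int q) *\<^sub>R of_int_vec u) x
        \<le> (\<Sum>j\<in>UNIV. \<bar>((1 / of_int q) *\<^sub>R of_int_vec u - x) $ j\<bar>)"
        unfolding dist_norm by (rule norm_le_l1_cart)
      also have "\<dots> < (\<Sum>j\<in>(UNIV::'n set). e / CARD('n))"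
        using comp by (intro sum_strict_mono) auto
      also have "\<dots> = e" by simp
      finally show ?thesis .
    qed
    ultimately show ?thesis by blast
  qed
  then have "x \<in> closure ?K" unfolding closure_approachable by blast
  then show ?thesis using closed_span by (metis closure_closed)
qed

lemma inner_matrix_transpose:
  fixes M :: "real ^ 'n ^ 'd"
  shows "(transpose M *v y) \<bullet> x = y \<bullet> (M *v x)"
  by (metis dot_lmul_matrix transpose_matrix_vector)

text \<open>
  The Gale equation in coordinate-free form: orthogonality passes from the rows of \<open>B\<close> to
  their integer span, which is the integer kernel, and from there to the real kernel.
\<close>

lemma orthogonal_gale_rows_imp_orthogonal_kernel:
  fixes A :: "nat ^ 'n ^ 'd"
  assumes gale: "gale_transform A B" and "gale_mult B w = gale_mult B w'"
    and ker: "real_mat A *v x = 0"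
  shows "(w - w') \<bullet> x = 0"
proof -
  interpret Z: module "(*s) :: int \<Rightarrow> int ^ 'n \<Rightarrow> int ^ 'n"
    by (rule module_int_vec)
  have rows: "(w - w') \<bullet> of_int_vec b = 0" if "b \<in> set B" for b
    using assms(2) that
    by (simp add: gale_mult_def inner_vec_def algebra_simps sum_subtractf)
  have ints: "(w - w') \<bullet> of_int_vec b = 0" if "b \<in> Z.span (set B)" for b
    using that
  proof (induction rule: Z.span_induct_alt)
    case base
    show ?case by (simp add: inner_vec_def)
  next
    case (step c b b')
    have "of_int_vec (c *s b + b') = of_int c *\<^sub>R of_int_vec b + of_int_vec b'"
      by (simp add: vec_eq_iff)
    then show ?case using step rows by (simp add: inner_add_right)
  qed
  have "x \<in> span (of_int_vec ` integer_kernel A)"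
    using ker by (rule real_kernel_in_span_integer_kernel)
  then show ?thesis
    using ints gale
    by (induction rule: span_induct_alt) (auto simp: gale_transform_def inner_add_right)
qed

section \<open>Existence and uniqueness of the moment point\<close>

lemma moment_point_unique:
  assumes gale: "gale_transform A B"
    and m: "is_moment_point A B \<beta> l m" and m': "is_moment_point A B \<beta> l m'"
  shows "m = m'"
proof -
  have "real_mat A *v (m - m') = 0"
    using m m' by (simp add: is_moment_point_def matrix_vector_mult_diff_distrib)
  then have "(log_vec m - log_vec m') \<bullet> (m - m') = 0"
    using gale m m' by (intro orthogonal_gale_rows_imp_orthogonal_kernel) (auto simp: is_moment_point_def)
  then have sum0: "(\<Sum>j\<in>UNIV. (ln (m $ j) - ln (m' $ j)) * (m $ j - m' $ j)) = 0"
    by (simp add: inner_vec_def log_vec_def)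
  have pos: "0 < m $ j" "0 < m' $ j" for j
    using m m' by (auto simp: is_moment_point_def)
  have "0 \<le> (ln (m $ j) - ln (m' $ j)) * (m $ j - m' $ j)" for j
    using pos[of j] by (cases "m $ j \<le> m' $ j") (auto intro: mult_nonpos_nonpos)
  then have "(ln (m $ j) - ln (m' $ j)) * (m $ j - m' $ j) = 0" for j
    using sum0 by (simp add: sum_nonneg_eq_0_iff)
  then show ?thesis
    using pos by (auto simp: vec_eq_iff)
qed

text \<open>
  For \<open>z \<ge> 0\<close> the bound is the tangent line of slope \<open>2 p\<close> to the convex function
  \<open>z \<mapsto> exp (\<xi> + z)\<close>, which touches at \<open>z = ln (2 p) - \<xi>\<close>; the spare slope \<open>p\<close> gives coercivity.
\<close>

lemma exp_minus_linear_coercive: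
  fixes p \<xi> z :: real
  assumes "p > 0"
  shows "exp (\<xi> + z) - p * z \<ge> p * \<bar>z\<bar> - 2 * p * \<bar>1 + \<xi> - ln (2 * p)\<bar>"
proof (cases "z \<ge> 0")
  case True
  have "2 * p * (1 + (\<xi> + z - ln (2 * p))) \<le> 2 * p * exp (\<xi> + z - ln (2 * p))"
    using assms by (intro mult_left_mono exp_ge_add_one_self) auto
  also have "\<dots> = exp (\<xi> + z)"
    using assms by (simp add: exp_diff)
  finally have "exp (\<xi> + z) \<ge> 2 * p * z + 2 * p * (1 + \<xi> - ln (2 * p))"
    by (simp add: algebra_simps)
  moreover have "2 * p * (1 + \<xi> - ln (2 * p)) \<ge> - (2 * p * \<bar>1 + \<xi> - ln (2 * p)\<bar>)"
  proof -
    have "2 * p * (1 + \<xi> - ln (2 * p)) \<ge> 2 * p * (- \<bar>1 + \<xi> - ln (2 * p)\<bar>)"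
      using assms by (intro mult_left_mono) auto
    then show ?thesis by simp
  qed
  ultimately show ?thesis using True by simp
next
  case False
  have "0 \<le> 2 * p * \<bar>1 + \<xi> - ln (2 * p)\<bar>" using assms by simp
  moreover have "0 < exp (\<xi> + z)" by simp
  moreover have "p * \<bar>z\<bar> = - (p * z)" using False by simp
  ultimately show ?thesis by linarith
qed

text \<open>
  The function \<open>G z = (\<Sum>j\<in>UNIV. exp (\<xi> $ j + z $ j) - p $ j * z $ j)\<close> is coercive because
  \<open>p > 0\<close>, so it attains its minimum on \<open>V\<close>; the conclusion says that the gradient of \<open>G\<close> at the
  minimiser is orthogonal to \<open>V\<close>. With \<open>V\<close> the row space this is the existence of a maximum
  likelihood estimate in a log-linear model.
\<close>

lemma exponential_family_projection:
  fixes V :: "(real ^ 'n) set" and p \<xi> :: "real ^ 'n"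
  assumes V: "subspace V" and p: "\<And>j. p $ j > 0"
  obtains z where "z \<in> V" and "\<And>v. v \<in> V \<Longrightarrow> ((\<chi> j. exp (\<xi> $ j + z $ j)) - p) \<bullet> v = 0"
proof -
  define G :: "real ^ 'n \<Rightarrow> real" where "G = (\<lambda>z. \<Sum>j\<in>UNIV. exp (\<xi> $ j + z $ j) - p $ j * z $ j)"
  define D where "D = (\<Sum>j\<in>UNIV. 2 * p $ j * \<bar>1 + \<xi> $ j - ln (2 * p $ j)\<bar>)"
  define c where "c = Min (range (\<lambda>j. p $ j))"
  have c: "c > 0" "\<And>j. c \<le> p $ j"
    using p by (auto simp: c_def)
  have coercive: "G z \<ge> c * norm z - D" for z
  proof -
    have "c * norm z \<le> c * (\<Sum>j\<in>UNIV. \<bar>z $ j\<bar>)"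
      using c norm_le_l1_cart[of z] by (intro mult_left_mono) auto
    also have "\<dots> \<le> (\<Sum>j\<in>UNIV. p $ j * \<bar>z $ j\<bar>)"
      unfolding sum_distrib_left using c by (intro sum_mono mult_right_mono) auto
    also have "\<dots> - D \<le> G z"
      unfolding D_def G_def sum_subtractf[symmetric]
      by (intro sum_mono exp_minus_linear_coercive p)
    finally show ?thesis by simp
  qed
  \<comment> \<open>outside the ball of radius \<open>R\<close>, coercivity makes \<open>G\<close> larger than \<open>G 0\<close>\<close>
  define R where "R = (\<bar>G 0\<bar> + \<bar>D\<bar>) / c"
  have "R \<ge> 0" using c by (simp add: R_def)
  have "0 \<in> V" using V by (rule subspace_0)
  have "compact (V \<inter> cball 0 R)"
    by (intro closed_Int_compact closed_subspace V compact_cball)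
  moreover have "V \<inter> cball 0 R \<noteq> {}"
    using \<open>0 \<in> V\<close> \<open>R \<ge> 0\<close> by auto
  moreover have "continuous_on (V \<inter> cball 0 R) G"
    unfolding G_def by (intro continuous_intros)
  ultimately obtain z where z: "z \<in> V" "\<And>y. y \<in> V \<Longrightarrow> norm y \<le> R \<Longrightarrow> G z \<le> G y"
    using continuous_attains_inf[of "V \<inter> cball 0 R" G]
    by (metis IntE IntI mem_cball_0)
  have min: "G z \<le> G y" if "y \<in> V" for y
  proof (cases "norm y \<le> R")
    case True
    then show ?thesis using z that by blast
  next
    case False
    have "G z \<le> G 0" using z \<open>0 \<in> V\<close> \<open>R \<ge> 0\<close> by simp
    also have "\<dots> \<le> c * R - D" using c by (simp add: R_def)
    also have "\<dots> \<le> c * norm y - D" using c False by simp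
    also have "\<dots> \<le> G y" by (rule coercive)
    finally show ?thesis .
  qed
  have "((\<chi> j. exp (\<xi> $ j + z $ j)) - p) \<bullet> v = 0" if "v \<in> V" for v
  proof -
    have "((\<lambda>t. G (z + t *\<^sub>R v)) has_real_derivative
        (\<Sum>j\<in>UNIV. exp (\<xi> $ j + z $ j) * v $ j - p $ j * v $ j)) (at 0)"
      unfolding G_def by (auto intro!: derivative_eq_intros simp: mult.commute)
    moreover have "G (z + 0 *\<^sub>R v) \<le> G (z + t *\<^sub>R v)" for t
      using min that z V by (simp add: subspace_add subspace_scale)
    ultimately have "(\<Sum>j\<in>UNIV. exp (\<xi> $ j + z $ j) * v $ j - p $ j * v $ j) = 0"
      by (intro DERIV_local_min[of "\<lambda>t. G (z + t *\<^sub>R v)" _ 0 1]) auto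
    then show ?thesis by (simp add: inner_vec_def algebra_simps)
  qed
  with z(1) show thesis by (rule that)
qed

text \<open>
  Subtracting from \<open>\<beta>\<close> a small multiple \<open>t\<close> of the sum of all columns stays in the cone; adding
  \<open>t\<close> to each coefficient of the resulting combination makes all coefficients positive.
\<close>

lemma interior_cone_positive_solution:
  fixes A :: "nat ^ 'n ^ 'd"
  assumes "\<beta> \<in> interior (real_cone A)"
  obtains p where "\<And>j. p $ j > 0" and "real_mat A *v p = \<beta>"
proof -
  obtain e where e: "e > 0" "ball \<beta> e \<subseteq> real_cone A"
    using assms by (auto simp: mem_interior)
  define w where "w = real_mat A *v (1 :: real ^ 'n)"
  define t where "t = e / (2 * (norm w + 1))"
  have t: "t > 0" using e by (simp add: t_def add_nonneg_pos)
  have "t * norm w \<le> t * (norm w + 1)" using t by simp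
  also have "\<dots> = e / 2"
    using add_nonneg_pos[OF norm_ge_zero[of w] zero_less_one] by (simp add: t_def del: distrib_left_numeral)
  also have "\<dots> < e" using e by simp
  finally have "\<beta> - t *\<^sub>R w \<in> ball \<beta> e" using t by (simp add: dist_norm)
  then have "\<beta> - t *\<^sub>R w \<in> real_cone A" using e by blast
  then obtain c where c: "\<And>j. 0 \<le> c j" "\<beta> - t *\<^sub>R w = (\<Sum>j\<in>UNIV. c j *\<^sub>R column j (real_mat A))"
    by (auto simp: real_cone_def)
  have "real_mat A *v (\<chi> j. c j) = \<beta> - t *\<^sub>R w"
    unfolding c(2) by (simp add: matrix_mult_sum scalar_mult_eq_scaleR)
  then have "real_mat A *v ((\<chi> j. c j) + t *\<^sub>R 1) = \<beta>"
    by (simp add: matrix_vector_right_distrib matrix_vector_mult_scaleR w_def)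
  moreover have "((\<chi> j. c j) + t *\<^sub>R 1) $ j > 0" for j
    using c(1)[of j] t by (simp add: add_nonneg_pos)
  ultimately show thesis using that by blast
qed

text \<open>
  The proof produces a solution for which \<open>log_vec m - \<xi>\<close> is visibly in the row space; the
  vector \<open>y\<close> is recorded because it drives the change of parameter in the fibres.
\<close>

lemma moment_point_exists:
  fixes A :: "nat ^ 'n ^ 'd"
  assumes "gale_transform A B" and "\<beta> \<in> interior (real_cone A)"
  obtains m y where "is_moment_point A B \<beta> (gale_mult B \<xi>) m"
    and "log_vec m = \<xi> + transpose (real_mat A) *v y"
proof -
  obtain p where p: "\<And>j. p $ j > 0" "real_mat A *v p = \<beta>"
    using interior_cone_positive_solution[OF assms(2)] by blast
  let ?V = "range (\<lambda>y. transpose (real_mat A) *v y)"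
  have "subspace ?V"
    by (intro linear_subspace_image matrix_vector_mul_linear) simp
  then obtain z where z: "z \<in> ?V"
    and orth: "\<And>v. v \<in> ?V \<Longrightarrow> ((\<chi> j. exp (\<xi> $ j + z $ j)) - p) \<bullet> v = 0"
    using exponential_family_projection[of ?V p \<xi>] p(1) by blast
  define m where "m = (\<chi> j. exp (\<xi> $ j + z $ j))"
  obtain y where y: "z = transpose (real_mat A) *v y" using z by blast
  have "y' \<bullet> (real_mat A *v (m - p)) = 0" for y'
    using orth[of "transpose (real_mat A) *v y'"]
    by (simp add: m_def inner_commute flip: inner_matrix_transpose)
  then have "real_mat A *v (m - p) = 0"
    by (metis inner_eq_zero_iff)
  then have Am: "real_mat A *v m = \<beta>"
    using p by (simp add: matrix_vector_mult_diff_distrib)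
  have log: "log_vec m = \<xi> + z"
    by (simp add: m_def log_vec_def vec_eq_iff)
  have "gale_mult B z = map (\<lambda>b. 0) B"
  proof -
    have "(\<Sum>j\<in>UNIV. real_of_int (b $ j) * z $ j) = 0" if "b \<in> set B" for b
    proof -
      interpret Z: module "(*s) :: int \<Rightarrow> int ^ 'n \<Rightarrow> int ^ 'n"
        by (rule module_int_vec)
      have "map_matrix int A *v b = 0"
        using assms(1) Z.span_base[OF that] by (auto simp: gale_transform_def)
      then have "real_mat A *v of_int_vec b = 0"
        by (simp add: real_mat_mult_of_int_vec vec_eq_iff)
      then have "z \<bullet> of_int_vec b = 0"
        by (simp add: y inner_matrix_transpose)
      then show ?thesis by (simp add: inner_vec_def mult.commute)
    qed
    then show ?thesis by (simp add: gale_mult_def)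
  qed
  then have "gale_mult B (log_vec m) = gale_mult B \<xi>"
    by (simp add: log gale_mult_def distrib_left sum.distrib)
  then have "is_moment_point A B \<beta> (gale_mult B \<xi>) m"
    using Am by (simp add: is_moment_point_def m_def)
  then show thesis using that log y by blast
qed


section \<open>Finite exponential sums over lattice points\<close>

text \<open>
  A weak form of Stirling's formula: only the error term \<open>o(n)\<close> matters below. The induction step
  reduces to \<open>1 / (n + 1) \<le> ln ((n + 1) / n)\<close>.
\<close>

lemma ln_fact_le:
  assumes "n \<ge> 1"
  shows "ln (fact n) \<le> real n * ln n - n + ln n + 1"
  using assms
proof (induction n rule: dec_induct)
  case base
  show ?case by simp
next
  case (step n)
  have "ln (real n / real (Suc n)) \<le> real n / real (Suc n) - 1"
    using step.hyps by (intro ln_le_minus_one) simp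
  also have "\<dots> = - (1 / real (Suc n))"
    by (simp add: field_simps)
  finally have "1 / real (Suc n) \<le> ln (real (Suc n)) - ln n"
    using step.hyps by (simp add: ln_div del: of_nat_Suc)
  then have "1 \<le> real (Suc n) * (ln (real (Suc n)) - ln n)"
    by (simp add: divide_le_eq mult.commute del: of_nat_Suc)
  moreover have "ln (fact (Suc n)) = ln (real (Suc n)) + ln (fact n)"
    by (simp add: ln_mult del: of_nat_Suc)
  ultimately show ?case
    using step.IH by (simp add: algebra_simps)
qed

lemma exp_le_quadratic:
  fixes t :: real
  assumes "\<bar>t\<bar> \<le> 1"
  shows "exp t \<le> 1 + t + t\<^sup>2"
proof (cases "t \<ge> 0")
  case True
  then show ?thesis using assms exp_bound by simp
next
  case False
  have "1 \<le> (1 - t) * (1 + t + t\<^sup>2)"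
    using False zero_le_even_power[of 2 t] mult_nonneg_nonneg[of "- t" "t\<^sup>2"]
    by (simp add: algebra_simps power2_eq_square)
  also have "\<dots> \<le> exp (- t) * (1 + t + t\<^sup>2)"
    using exp_ge_add_one_self[of "- t"] False assms
    by (intro mult_right_mono) auto
  finally show ?thesis
    by (simp add: exp_minus field_simps)
qed

lemma exp_inner_real_vec: "exp (real_vec u \<bullet> x) = (\<Prod>j\<in>UNIV. exp (x $ j) ^ (u $ j))"
  by (simp add: inner_vec_def exp_sum flip: exp_of_nat_mult)

lemma vec_fact_pos: "vec_fact u > 0"
  by (simp add: vec_fact_def prod_pos)

lemma finite_nat_vec_bounded: "finite {u :: nat ^ 'n. \<forall>j. u $ j \<le> N}"
proof (rule finite_surj)
  show "finite (PiE (UNIV :: 'n set) (\<lambda>_. {..N}))"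
    by (intro finite_PiE) auto
  show "{u. \<forall>j. u $ j \<le> N} \<subseteq> vec_lambda ` PiE (UNIV :: 'n set) (\<lambda>_. {..N})"
  proof
    fix u :: "nat ^ 'n"
    assume "u \<in> {u. \<forall>j. u $ j \<le> N}"
    then show "u \<in> vec_lambda ` PiE (UNIV :: 'n set) (\<lambda>_. {..N})"
      by (intro image_eqI[of _ _ "vec_nth u"]) auto
  qed
qed

text \<open>
  The right-hand side is the same sum over all of \<open>\<nat>\<^sup>n\<close>, as a product of
  exponential series. Enclosing \<open>S\<close> in a box avoids infinite families.
\<close>

lemma sum_exp_inner_div_fact_le:
  fixes S :: "(nat ^ 'n) set" and x :: "real ^ 'n"
  assumes "finite S"
  shows "(\<Sum>u\<in>S. exp (real_vec u \<bullet> x) / vec_fact u) \<le> exp (\<Sum>j\<in>UNIV. exp (x $ j))"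
proof -
  define N where "N = Suc (\<Sum>u\<in>S. \<Sum>j\<in>UNIV. u $ j)"
  have N: "u $ j < N" if "u \<in> S" for u j
  proof -
    have "u $ j \<le> (\<Sum>j\<in>UNIV. u $ j)" by (rule member_le_sum) auto
    also have "\<dots> \<le> (\<Sum>u\<in>S. \<Sum>j\<in>UNIV. u $ j)" using that assms by (intro member_le_sum) auto
    finally show ?thesis by (simp add: N_def)
  qed
  define f :: "'n \<Rightarrow> nat \<Rightarrow> real" where "f = (\<lambda>j i. exp (x $ j) ^ i / fact i)"
  have f_nonneg: "f j i \<ge> 0" for j i by (simp add: f_def)
  have "(\<Sum>u\<in>S. exp (real_vec u \<bullet> x) / vec_fact u) = (\<Sum>u\<in>S. \<Prod>j\<in>UNIV. f j (u $ j))"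
    by (simp add: f_def exp_inner_real_vec vec_fact_def prod_dividef)
  also have "\<dots> = (\<Sum>g\<in>vec_nth ` S. \<Prod>j\<in>UNIV. f j (g j))"
    by (subst sum.reindex) (auto simp: inj_on_def vec_nth_inject)
  also have "\<dots> \<le> (\<Sum>g\<in>PiE UNIV (\<lambda>_. {..<N}). \<Prod>j\<in>UNIV. f j (g j))"
    using N by (intro sum_mono2 finite_PiE) (auto intro!: prod_nonneg f_nonneg)
  also have "\<dots> = (\<Prod>j\<in>UNIV. \<Sum>i<N. f j i)"
    by (rule prod_sum_PiE[symmetric]) auto
  also have "\<dots> \<le> (\<Prod>j\<in>UNIV. exp (exp (x $ j)))"
  proof (intro prod_mono conjI sum_nonneg f_nonneg)
    fix j
    have "(\<Sum>i<N. f j i) \<le> suminf (f j)"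
      using summable_exp[of "exp (x $ j)"] f_nonneg
      by (intro sum_le_suminf) (auto simp: f_def field_simps)
    also have "\<dots> = exp (exp (x $ j))"
      using sums_unique[OF exp_converges[of "exp (x $ j)"]]
      by (simp add: f_def divide_inverse mult.commute)
    finally show "(\<Sum>i<N. f j i) \<le> exp (exp (x $ j))" .
  qed
  also have "\<dots> = exp (\<Sum>j\<in>UNIV. exp (x $ j))"
    by (simp add: exp_sum)
  finally show ?thesis .
qed

text \<open>
  This is the Chernoff bound for a Poisson vector of means \<open>exp (\<eta> $ j)\<close> conditioned on \<open>S\<close>,
  stated for the mean rather than for tail probabilities. The last bracket is the price of the
  conditioning: the total weight \<open>Z\<close> is bounded from below by the weight of the single point \<open>u\<^sub>0\<close>.
\<close>

lemma mean_le_log_moment_bound: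
  fixes S :: "(nat ^ 'n) set" and \<eta> \<theta> :: "real ^ 'n"
  assumes S: "finite S" "u\<^sub>0 \<in> S"
  defines "Z \<equiv> \<Sum>u\<in>S. exp (real_vec u \<bullet> \<eta>) / vec_fact u"
  shows "\<theta> \<bullet> (\<Sum>u\<in>S. (exp (real_vec u \<bullet> \<eta>) / (vec_fact u * Z)) *\<^sub>R real_vec u)
    \<le> (\<Sum>j\<in>UNIV. exp (\<eta> $ j + \<theta> $ j)) + (ln (vec_fact u\<^sub>0) - real_vec u\<^sub>0 \<bullet> \<eta>)"
    (is "?mean \<le> ?b")
proof -
  define b where "b = ?b"
  define M where "M = ?mean"
  define w where "w = (\<lambda>u. exp (real_vec u \<bullet> \<eta>) / vec_fact u)"
  have w_nonneg: "w u \<ge> 0" for u using vec_fact_pos[of u] by (simp add: w_def)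
  have Z: "Z = sum w S" by (simp add: Z_def w_def)
  have "w u\<^sub>0 \<le> Z"
    unfolding Z using S w_nonneg by (intro member_le_sum) auto
  moreover have "w u\<^sub>0 > 0" using vec_fact_pos[of u\<^sub>0] by (simp add: w_def)
  ultimately have "Z > 0" by linarith
  have ZM: "Z * M = (\<Sum>u\<in>S. w u * (\<theta> \<bullet> real_vec u))"
    using \<open>Z > 0\<close> by (simp add: M_def w_def inner_sum_right sum_distrib_left field_simps)
  \<comment> \<open>the tangent line of the exponential at \<open>b\<close>, averaged with the weights \<open>w\<close>\<close>
  have "exp b * (Z * (1 + M - b)) = exp b * (Z * M + Z * (1 - b))"
    by (simp add: algebra_simps)
  also have "\<dots> = exp b * (\<Sum>u\<in>S. w u * (\<theta> \<bullet> real_vec u) + w u * (1 - b))"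
    by (simp only: ZM) (simp add: Z sum.distrib sum_distrib_right)
  also have "\<dots> = (\<Sum>u\<in>S. w u * (exp b * (1 + (\<theta> \<bullet> real_vec u - b))))"
    by (simp add: sum_distrib_left algebra_simps)
  also have "\<dots> \<le> (\<Sum>u\<in>S. w u * exp (\<theta> \<bullet> real_vec u))"
  proof (intro sum_mono mult_left_mono w_nonneg)
    fix u
    have "exp b * (1 + (\<theta> \<bullet> real_vec u - b)) \<le> exp b * exp (\<theta> \<bullet> real_vec u - b)"
      by (intro mult_left_mono exp_ge_add_one_self) auto
    then show "exp b * (1 + (\<theta> \<bullet> real_vec u - b)) \<le> exp (\<theta> \<bullet> real_vec u)"
      by (simp add: exp_diff)
  qed
  also have "\<dots> = (\<Sum>u\<in>S. exp (real_vec u \<bullet> (\<eta> + \<theta>)) / vec_fact u)"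
    by (simp add: w_def inner_add_right exp_add inner_commute)
  also have "\<dots> \<le> exp (\<Sum>j\<in>UNIV. exp (\<eta> $ j + \<theta> $ j))"
    using sum_exp_inner_div_fact_le[OF S(1), of "\<eta> + \<theta>"] by simp
  also have "\<dots> = exp b * w u\<^sub>0"
    using vec_fact_pos[of u\<^sub>0] by (simp add: b_def w_def exp_add exp_diff)
  also have "\<dots> \<le> exp b * Z"
    using \<open>w u\<^sub>0 \<le> Z\<close> by simp
  finally have "Z * (1 + M - b) \<le> Z * 1" by simp
  then have "M \<le> b" using \<open>Z > 0\<close> by (simp only: mult_le_cancel_left_pos)
  then show ?thesis by (simp only: M_def b_def)
qed

section \<open>The distribution on a fibre\<close>

lemma fibre_inner_transpose:
  fixes A :: "nat ^ 'n ^ 'd"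
  assumes "u \<in> fibre A \<beta> k"
  shows "real_vec u \<bullet> (transpose (real_mat A) *v y) = real k * (\<beta> \<bullet> y)"
  using assms inner_matrix_transpose[of "real_mat A" y "real_vec u"]
  by (simp add: fibre_def inner_commute)

text \<open>
  The all-ones vector lies in the row space, so the coordinate sum is constant on the fibre.
\<close>

lemma finite_fibre:
  fixes A :: "nat ^ 'n ^ 'd"
  assumes "configuration_matrix A"
  shows "finite (fibre A \<beta> k)"
proof -
  obtain y where y: "(\<chi> j. 1) = transpose (real_mat A) *v y"
    using assms by (auto simp: configuration_matrix_def)
  have "u $ j \<le> nat \<lfloor>real k * (\<beta> \<bullet> y)\<rfloor>" if "u \<in> fibre A \<beta> k" for u j
  proof -
    have "real (u $ j) \<le> (\<Sum>j\<in>UNIV. real (u $ j))"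
      by (rule member_le_sum) auto
    also have "\<dots> = real_vec u \<bullet> (\<chi> j. 1)"
      by (simp add: inner_vec_def)
    also have "\<dots> = real k * (\<beta> \<bullet> y)"
      unfolding y using that by (rule fibre_inner_transpose)
    finally show ?thesis by (simp add: le_nat_floor)
  qed
  then show ?thesis
    by (intro finite_subset[OF _ finite_nat_vec_bounded]) auto
qed

text \<open>
  On the fibre, the inner product with a row space vector is constant, so the tilt multiplies all
  weights and the partition function by the same factor.
\<close>

lemma fibre_prob_add_row_space:
  fixes A :: "nat ^ 'n ^ 'd"
  assumes "u \<in> fibre A \<beta> k"
  shows "fibre_prob A \<beta> k u (\<xi> + transpose (real_mat A) *v y) = fibre_prob A \<beta> k u \<xi>"
proof -
  have weight: "exp (real_vec v \<bullet> (\<xi> + transpose (real_mat A) *v y))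
      = exp (real k * (\<beta> \<bullet> y)) * exp (real_vec v \<bullet> \<xi>)" if "v \<in> fibre A \<beta> k" for v
    using that by (simp add: inner_add_right fibre_inner_transpose exp_add)
  have "partition_fun A \<beta> k (\<xi> + transpose (real_mat A) *v y)
      = exp (real k * (\<beta> \<bullet> y)) * partition_fun A \<beta> k \<xi>"
    by (simp add: partition_fun_def weight sum_distrib_left)
  then show ?thesis
    by (simp add: fibre_prob_def weight[OF assms])
qed

section \<open>Lattice points close to the moment point\<close>

lemma floor_mult_div_tendsto: "(\<lambda>k. of_int \<lfloor>real k * c\<rfloor> / real k) \<longlonglongrightarrow> c"
proof (rule tendsto_sandwich)
  show "\<forall>\<^sub>F k in sequentially. c - 1 / real k \<le> of_int \<lfloor>real k * c\<rfloor> / real k"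
    using eventually_gt_at_top[of 0]
  proof eventually_elim
    case (elim k)
    have "real k * c - 1 \<le> of_int \<lfloor>real k * c\<rfloor>" by linarith
    then have "(real k * c - 1) / real k \<le> of_int \<lfloor>real k * c\<rfloor> / real k"
      by (rule divide_right_mono) simp
    then show ?case using elim by (simp add: diff_divide_distrib)
  qed
  show "\<forall>\<^sub>F k in sequentially. of_int \<lfloor>real k * c\<rfloor> / real k \<le> c"
    using eventually_gt_at_top[of 0]
    by eventually_elim (simp add: divide_le_eq mult.commute)
  show "(\<lambda>k. c - 1 / real k) \<longlonglongrightarrow> c"
    using tendsto_diff[OF tendsto_const[of c] lim_1_over_n] by simp
qed simp

text \<open>
  Let \<open>v\<close> be a natural solution of \<open>A v = \<beta>\<close> and write \<open>m - v\<close> as a real combination of integer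
  kernel vectors. Rounding down the coefficients of \<open>k (m - v)\<close> keeps \<open>k v + k (m - v) = k m\<close> in the
  fibre up to a bounded error, and makes it an integer point. It is eventually nonnegative
  because \<open>m > 0\<close>.
\<close>

lemma lattice_points_near_ray:
  fixes A :: "nat ^ 'n ^ 'd"
  assumes \<beta>: "\<beta> \<in> nat_cone A" and m: "\<And>j. m $ j > 0" "real_mat A *v m = \<beta>"
  obtains U where "\<forall>\<^sub>F k in sequentially. U k \<in> fibre A \<beta> k"
    and "\<And>j. (\<lambda>k. real (U k $ j) / real k) \<longlonglongrightarrow> m $ j"
proof -
  obtain c :: "'n \<Rightarrow> nat" where "\<beta> = (\<Sum>j\<in>UNIV. real (c j) *\<^sub>R column j (real_mat A))"
    using \<beta> by (auto simp: nat_cone_def)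
  then have v: "real_mat A *v real_vec (\<chi> j. c j) = \<beta>"
    by (simp add: matrix_mult_sum scalar_mult_eq_scaleR)
  define v where "v = real_vec (\<chi> j. c j)"
  have "real_mat A *v (m - v) = 0"
    using m(2) v by (simp add: matrix_vector_mult_diff_distrib v_def)
  then have "m - v \<in> span (of_int_vec ` integer_kernel A)"
    by (rule real_kernel_in_span_integer_kernel)
  then obtain T r where T: "finite T" "T \<subseteq> of_int_vec ` integer_kernel A"
    and mv: "m - v = (\<Sum>a\<in>T. r a *\<^sub>R a)"
    by (auto simp: span_explicit)
  define V where "V = (\<lambda>k. real k *\<^sub>R v + (\<Sum>a\<in>T. of_int \<lfloor>real k * r a\<rfloor> *\<^sub>R a))"
  have "real_mat A *v a = 0" if "a \<in> T" for a
    using T(2) that by (auto simp: real_mat_mult_of_int_vec vec_eq_iff)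
  then have AV: "real_mat A *v V k = real k *\<^sub>R \<beta>" for k
    using v by (simp add: V_def v_def matrix_vector_right_distrib matrix_vector_mult_scaleR
        linear_sum[OF matrix_vector_mul_linear])
  have V_int: "V k $ j \<in> \<int>" for k j
  proof -
    have "a $ j \<in> \<int>" if "a \<in> T" for a using T(2) that by auto
    then show ?thesis by (auto simp: V_def v_def)
  qed
  have V_lim: "(\<lambda>k. V k $ j / real k) \<longlonglongrightarrow> m $ j" for j
  proof -
    have "(\<lambda>k. v $ j + (\<Sum>a\<in>T. of_int \<lfloor>real k * r a\<rfloor> / real k * a $ j)) \<longlonglongrightarrow> v $ j + (\<Sum>a\<in>T. r a * a $ j)"
      by (intro tendsto_intros floor_mult_div_tendsto)
    also have "v $ j + (\<Sum>a\<in>T. r a * a $ j) = m $ j"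
      using arg_cong[OF mv, of "\<lambda>x. x $ j"] by simp
    finally show ?thesis
    proof (rule Lim_transform_eventually)
      show "\<forall>\<^sub>F k in sequentially. v $ j + (\<Sum>a\<in>T. of_int \<lfloor>real k * r a\<rfloor> / real k * a $ j) = V k $ j / real k"
        using eventually_gt_at_top[of 0]
        by eventually_elim (simp add: V_def add_divide_distrib sum_divide_distrib)
    qed
  qed
  define U :: "nat \<Rightarrow> nat ^ 'n" where "U = (\<lambda>k. \<chi> j. nat \<lfloor>V k $ j\<rfloor>)"
  have "\<forall>\<^sub>F k in sequentially. \<forall>j. 0 < V k $ j / real k"
    using order_tendstoD(1)[OF V_lim m(1)] by (simp add: eventually_all_finite)
  then have UV: "\<forall>\<^sub>F k in sequentially. real_vec (U k) = V k"
  proof eventually_elim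
    case (elim k)
    have "real (nat \<lfloor>V k $ j\<rfloor>) = V k $ j" for j
      using V_int[of k j] elim[rule_format, of j] by (auto simp: Ints_def zero_less_divide_iff)
    then show ?case by (simp add: vec_eq_iff U_def)
  qed
  show thesis
  proof (rule that)
    show "\<forall>\<^sub>F k in sequentially. U k \<in> fibre A \<beta> k"
      using UV by eventually_elim (simp add: fibre_def AV)
    show "(\<lambda>k. real (U k $ j) / real k) \<longlonglongrightarrow> m $ j" for j
      using V_lim[of j]
    proof (rule Lim_transform_eventually)
      show "\<forall>\<^sub>F k in sequentially. V k $ j / real k = real (U k $ j) / real k"
        using UV by eventually_elim (metis real_vec_nth)
    qed
  qed
qed

section \<open>Convergence of the means\<close>

text \<open>
  Dividing by \<open>t > 0\<close> and by \<open>- t < 0\<close> bounds the limit points of \<open>X\<close> within \<open>c t\<close> of \<open>a\<close>, for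
  every small \<open>t\<close>.
\<close>

lemma tendsto_of_two_sided_exponential_bound:
  fixes X T :: "nat \<Rightarrow> real"
  assumes bound: "\<forall>\<^sub>F k in sequentially. \<forall>t. \<bar>t\<bar> \<le> 1 \<longrightarrow> t * (X k - a) \<le> c * t\<^sup>2 + T k"
    and T: "T \<longlonglongrightarrow> 0" and c: "c \<ge> 0"
  shows "X \<longlonglongrightarrow> a"
proof (rule tendstoI)
  fix e :: real
  assume "e > 0"
  define t where "t = min 1 (e / (2 * (c + 1)))"
  have t: "0 < t" "t \<le> 1" using \<open>e > 0\<close> c by (auto simp: t_def)
  have "(c + 1) * t \<le> (c + 1) * (e / (2 * (c + 1)))"
    using c by (intro mult_left_mono) (auto simp: t_def)
  also have "\<dots> = e / 2" using c by (simp add: field_simps)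
  finally have ct: "c * t \<le> e / 2 " using t by (simp add: algebra_simps)
  have "t * e / 2 > 0" using t \<open>e > 0\<close> by simp
  then have "\<forall>\<^sub>F k in sequentially. T k < t * e / 2"
    using T by (rule order_tendstoD(2)[rotated])
  with bound show "\<forall>\<^sub>F k in sequentially. dist (X k) a < e"
  proof eventually_elim
    case (elim k)
    have "t * (X k - a) \<le> c * t\<^sup>2 + T k" "- t * (X k - a) \<le> c * t\<^sup>2 + T k"
      using elim(1)[rule_format, of t] elim(1)[rule_format, of "- t"] t by auto
    then have "t * \<bar>X k - a\<bar> \<le> t * (c * t) + T k"
      by (auto simp: abs_if power2_eq_square algebra_simps)
    also have "\<dots> < t * (c * t) + t * e / 2" using elim(2) by simp
    also have "\<dots> \<le> t * (e / 2) + t * e / 2"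
      using mult_left_mono[OF ct less_imp_le[OF t(1)]] by linarith
    also have "\<dots> = t * e" by simp
    finally show ?case using t by (simp add: dist_real_def)
  qed
qed

text \<open>
  The left-hand side of the inequality is the negative logarithm of the probability that a Poisson
  variable of mean \<open>k \<mu>\<close> takes the value \<open>u k\<close>. By Stirling's estimate, its quotient by \<open>k\<close> is at most
  \<open>x ln (x / \<mu>) - x + \<mu> + o(1)\<close> at \<open>x = u k / k\<close>, and this relative entropy is \<open>0\<close> at \<open>x = \<mu>\<close>.
\<close>

lemma log_weight_defect_tendsto_0:
  fixes u :: "nat \<Rightarrow> nat"
  assumes lim: "(\<lambda>k. real (u k) / real k) \<longlonglongrightarrow> \<mu>" and \<mu>: "\<mu> > 0"
  obtains T where "T \<longlonglongrightarrow> 0"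
    and "\<forall>\<^sub>F k in sequentially. real k * \<mu> + ln (fact (u k)) - real (u k) * (ln k + ln \<mu>) \<le> real k * T k"
proof -
  define x where "x = (\<lambda>k. real (u k) / real k)"
  define T where "T = (\<lambda>k. \<mu> - x k * ln \<mu> + x k * ln (x k) - x k + ln (real k) / real k + (ln (x k) + 1) * (1 / real k))"
  have x: "x \<longlonglongrightarrow> \<mu>" using lim by (simp add: x_def)
  have "T \<longlonglongrightarrow> \<mu> - \<mu> * ln \<mu> + \<mu> * ln \<mu> - \<mu> + 0 + (ln \<mu> + 1) * 0"
    unfolding T_def using \<mu> by (intro tendsto_intros x lim_ln_over_n lim_1_over_n) auto
  then have "T \<longlonglongrightarrow> 0" by simp
  moreover have "\<forall>\<^sub>F k in sequentially. real k * \<mu> + ln (fact (u k)) - real (u k) * (ln k + ln \<mu>) \<le> real k * T k"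
    using order_tendstoD(1)[OF x \<mu>] eventually_gt_at_top[of 0]
  proof eventually_elim
    case (elim k)
    have u: "u k \<ge> 1" using elim by (cases "u k") (auto simp: x_def)
    have ux: "real (u k) = real k * x k" using elim by (simp add: x_def)
    have "ln (real (u k)) = ln k + ln (x k)" using elim by (simp add: ux ln_mult)
    then have "ln (fact (u k)) \<le> real k * x k * (ln k + ln (x k)) - real k * x k + (ln k + ln (x k)) + 1"
      using ln_fact_le[OF u] by (simp add: ux)
    then show ?case
      using elim by (simp add: ux T_def algebra_simps)
  qed
  ultimately show thesis by (rule that)
qed

text \<open>
  The reduction to the conditioned Poisson vector: \<open>\<eta>\<close> in the proof is the componentwise
  logarithm of \<open>k m\<close>, and \<open>\<theta> = axis i t\<close> in \<open>mean_le_log_moment_bound\<close> isolates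
  coordinate \<open>i\<close>.
\<close>

lemma fibre_mean_tendsto:
  fixes A :: "nat ^ 'n ^ 'd"
  assumes conf: "configuration_matrix A" and \<beta>: "\<beta> \<in> nat_cone A"
    and m: "\<And>j. m $ j > 0" "real_mat A *v m = \<beta>"
    and log: "log_vec m = \<xi> + transpose (real_mat A) *v y"
  shows "(\<lambda>k. (1 / real k) *\<^sub>R (\<Sum>u\<in>fibre A \<beta> k. fibre_prob A \<beta> k u \<xi> *\<^sub>R real_vec u)) \<longlonglongrightarrow> m"
proof -
  define E where "E = (\<lambda>k. \<Sum>u\<in>fibre A \<beta> k. fibre_prob A \<beta> k u \<xi> *\<^sub>R real_vec u)"
  obtain U where U: "\<forall>\<^sub>F k in sequentially. U k \<in> fibre A \<beta> k"
    and U_lim: "\<And>j. (\<lambda>k. real (U k $ j) / real k) \<longlonglongrightarrow> m $ j"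
    using lattice_points_near_ray[OF \<beta> m] by blast
  have "\<exists>T. T \<longlonglongrightarrow> 0 \<and> (\<forall>\<^sub>F k in sequentially. real k * m $ j + ln (fact (U k $ j))
      - real (U k $ j) * (ln k + ln (m $ j)) \<le> real k * T k)" for j
    by (rule log_weight_defect_tendsto_0[OF U_lim[of j] m(1)]) blast
  then have "\<exists>T. \<forall>j. T j \<longlonglongrightarrow> 0 \<and> (\<forall>\<^sub>F k in sequentially. real k * m $ j + ln (fact (U k $ j))
      - real (U k $ j) * (ln k + ln (m $ j)) \<le> real k * T j k)"
    by (intro choice allI)
  then obtain T where T: "\<And>j. T j \<longlonglongrightarrow> 0"
    and defect: "\<And>j. \<forall>\<^sub>F k in sequentially. real k * m $ j + ln (fact (U k $ j))
      - real (U k $ j) * (ln k + ln (m $ j)) \<le> real k * T j k"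
    by blast
  have defects: "\<forall>\<^sub>F k in sequentially. \<forall>j. real k * m $ j + ln (fact (U k $ j))
      - real (U k $ j) * (ln k + ln (m $ j)) \<le> real k * T j k"
    by (intro eventually_all_finite defect)
  obtain y\<^sub>1 where y\<^sub>1: "(\<chi> j. 1) = transpose (real_mat A) *v y\<^sub>1"
    using conf by (auto simp: configuration_matrix_def)
  have bound: "\<forall>\<^sub>F k in sequentially. \<forall>t. \<bar>t\<bar> \<le> 1 \<longrightarrow>
      t * (E k $ i / real k - m $ i) \<le> m $ i * t\<^sup>2 + (\<Sum>j\<in>UNIV. T j k)" for i
    using U eventually_gt_at_top[of 0] defects
  proof eventually_elim
    case (elim k)
    define \<eta> where "\<eta> = \<xi> + transpose (real_mat A) *v (y + ln k *\<^sub>R y\<^sub>1)"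
    have \<eta>: "\<eta> $ j = ln k + ln (m $ j)" for j
    proof -
      have "\<eta> = log_vec m + ln k *\<^sub>R (\<chi> j. 1)"
        by (simp add: \<eta>_def log y\<^sub>1 matrix_vector_right_distrib matrix_vector_mult_scaleR)
      then show ?thesis by (simp add: log_vec_def)
    qed
    have exp_\<eta>: "exp (\<eta> $ j) = real k * m $ j" for j
      using elim m(1)[of j] by (simp add: \<eta> exp_add)
    have E_\<eta>: "E k = (\<Sum>u\<in>fibre A \<beta> k. (exp (real_vec u \<bullet> \<eta>) / (vec_fact u * partition_fun A \<beta> k \<eta>)) *\<^sub>R real_vec u)"
      unfolding E_def \<eta>_def by (intro sum.cong refl) (metis fibre_prob_add_row_space fibre_prob_def)
    have ln_fact: "ln (vec_fact (U k)) - real_vec (U k) \<bullet> \<eta>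
        = (\<Sum>j\<in>UNIV. ln (fact (U k $ j)) - real (U k $ j) * (ln k + ln (m $ j)))"
      by (simp add: vec_fact_def ln_prod inner_vec_def \<eta> sum_subtractf)
    have "t * (E k $ i / real k - m $ i) \<le> m $ i * t\<^sup>2 + (\<Sum>j\<in>UNIV. T j k)" if "\<bar>t\<bar> \<le> 1" for t
    proof -
      have "t * E k $ i = axis i t \<bullet> E k"
        by (simp add: inner_axis inner_commute)
      also have "\<dots> \<le> (\<Sum>j\<in>UNIV. exp (\<eta> $ j + axis i t $ j)) + (ln (vec_fact (U k)) - real_vec (U k) \<bullet> \<eta>)"
        unfolding E_\<eta> partition_fun_def
        by (intro mean_le_log_moment_bound finite_fibre conf elim)
      \<comment> \<open>split off the total mean \<open>k (\<Sum>j\<in>UNIV. m $ j)\<close>, which completes the defects of \<open>U k\<close>\<close>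
      also have "(\<Sum>j\<in>UNIV. exp (\<eta> $ j + axis i t $ j))
          = (\<Sum>j\<in>UNIV. real k * m $ j + (if j = i then real k * m $ i * (exp t - 1) else 0))"
        by (intro sum.cong) (auto simp: exp_add exp_\<eta> axis_def algebra_simps)
      also have "\<dots> = real k * m $ i * (exp t - 1) + (\<Sum>j\<in>UNIV. real k * m $ j)"
        by (simp add: sum.distrib)
      also have "\<dots> + (ln (vec_fact (U k)) - real_vec (U k) \<bullet> \<eta>)
          = real k * m $ i * (exp t - 1) + (\<Sum>j\<in>UNIV. real k * m $ j + ln (fact (U k $ j))
              - real (U k $ j) * (ln k + ln (m $ j)))"
        by (simp add: ln_fact sum_subtractf sum.distrib)
      also have "\<dots> \<le> real k * m $ i * (t + t\<^sup>2) + (\<Sum>j\<in>UNIV. real k * T j k)"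
        using elim(3) exp_le_quadratic[OF that] m(1)[of i]
        by (intro add_mono sum_mono mult_left_mono) auto
      finally have "t * E k $ i / real k \<le> (real k * m $ i * (t + t\<^sup>2) + (\<Sum>j\<in>UNIV. real k * T j k)) / real k"
        by (rule divide_right_mono) simp
      also have "\<dots> = m $ i * (t + t\<^sup>2) + (\<Sum>j\<in>UNIV. T j k)"
        using elim by (simp add: add_divide_distrib flip: sum_distrib_left)
      finally show ?thesis by (simp add: algebra_simps)
    qed
    then show ?case by blast
  qed
  have "(\<lambda>k. \<Sum>j\<in>UNIV. T j k) \<longlonglongrightarrow> 0"
    using tendsto_sum[of UNIV T "\<lambda>_. 0"] T by simp
  then have "(\<lambda>k. E k $ i / real k) \<longlonglongrightarrow> m $ i" for i
    using tendsto_of_two_sided_exponential_bound[OF bound] m(1) less_imp_le by blast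
  then have "(\<lambda>k. (1 / real k) *\<^sub>R E k) \<longlonglongrightarrow> m"
    by (intro vec_tendstoI) simp
  then show ?thesis by (simp add: E_def)
qed

theorem theorem5:
  fixes A :: "nat ^ 'n ^ 'd"
    and B :: "(int ^ 'n) list"
    and \<beta> :: "real ^ 'd"
    and \<xi> :: "real ^ 'n"
  assumes "rank (real_mat A) = CARD('d)"
    and "configuration_matrix A"
    and "gale_transform A B"
    and "\<beta> \<in> nat_cone A \<inter> interior (real_cone A)"
  shows "(\<exists>!m. is_moment_point A B \<beta> (gale_mult B \<xi>) m) \<and>
    (\<lambda>k. (1 / real k) *\<^sub>R (\<Sum>u\<in>fibre A \<beta> k. fibre_prob A \<beta> k u \<xi> *\<^sub>R real_vec u))
      \<longlonglongrightarrow> moment_point A B \<beta> (gale_mult B \<xi>)"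
proof -
  obtain m y where m: "is_moment_point A B \<beta> (gale_mult B \<xi>) m"
    and log: "log_vec m = \<xi> + transpose (real_mat A) *v y"
    using moment_point_exists[of A B \<beta> \<xi>] assms(3,4) by blast
  have unique: "\<exists>!m. is_moment_point A B \<beta> (gale_mult B \<xi>) m"
    using m moment_point_unique[OF assms(3)] by blast
  then have "moment_point A B \<beta> (gale_mult B \<xi>) = m"
    unfolding moment_point_def using m by (rule the1_equality)
  moreover have "(\<lambda>k. (1 / real k) *\<^sub>R (\<Sum>u\<in>fibre A \<beta> k. fibre_prob A \<beta> k u \<xi> *\<^sub>R real_vec u)) \<longlonglongrightarrow> m"
    using assms(2,4) m log by (intro fibre_mean_tendsto) (auto simp: is_moment_point_def)
  ultimately show ?thesis using unique by simp
qed

end
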